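(* Let $X$ be a real random variable whose mean $m = E[X]$ and variance $\mathrm{Var}[X]$ exist (are finite), and let $g$ be a real polynomial of degree $2$. Then the statistical differential approximation for the expected value of $g(X)$ is exact, i.e. $$E[g(X)] = g(m) + \frac{g''(m)}{2!}\,\mathrm{Var}[X].$$
   Context: For a real random variable $X$ with mean $m=E[X]$ and finite variance, and a real function $g$, the statistical differential approximation for $E[g(X)]$ is $E[g(X)] \cong g(m) + \frac{g''(m)}{2!}\mathrm{Var}[X]$, obtained by truncating the Taylor expansion of $g$ about $m$ and taking expectations. It is called exact if equality holds. *)

theory Defs
  imports "HOL-Probability.Probability" "HOL-Computational_Algebra.Polynomial"
begin

definition stat_diff_approx :: "'a measure \<Rightarrow> ('a \<Rightarrow> real) \<Rightarrow> (real \<Rightarrow> real) \<Rightarrow> real" where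
  "stat_diff_approx M X g =
     (let m = prob_space.expectation M X
      in g m + (deriv ^^ 2) g m / fact 2 * prob_space.variance M X)"

(* The Bochner integral of a non-integrable function is 0 by convention, so the
   existence of E[g(X)] has to be stated separately from the equation. *)
definition stat_diff_exact :: "'a measure \<Rightarrow> ('a \<Rightarrow> real) \<Rightarrow> (real \<Rightarrow> real) \<Rightarrow> bool" where
  "stat_diff_exact M X g \<longleftrightarrow>
     integrable M (\<lambda>\<omega>. g (X \<omega>)) \<and>
     prob_space.expectation M (\<lambda>\<omega>. g (X \<omega>)) = stat_diff_approx M X g"

end

theory Submission
  imports Defs
begin

text \<open>
  A polynomial \<open>p\<close> of degree at most two equals its second-order Taylor polynomial
  about every point, so truncating the expansion about \<open>m = E[X]\<close> loses nothing:
  \<open>p (X) = p (m) + p' (m) (X - m) + p'' (m) / 2 * (X - m)\<^sup>2\<close> holds pointwise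
  (\<open>poly_quadratic_taylor\<close>). The constant summand is integrable
  because a probability measure is finite, the others because \<open>X\<close> and \<open>(X - m)\<^sup>2\<close>
  are. Taking expectations, the linear term vanishes since \<open>X - m\<close> is
  centred, and the quadratic term contributes \<open>p'' (m) / 2\<close> times the variance. The analytic
  second derivative in the approximation is the formal one (\<open>higher_deriv_poly\<close>).
\<close>

lemma higher_deriv_poly:
  fixes p :: "'a :: real_normed_field poly"
  shows "(deriv ^^ n) (poly p) = poly ((pderiv ^^ n) p)"
proof (induction n)
  case (Suc n)
  then show ?case
    by (simp add: DERIV_imp_deriv[OF poly_DERIV] ext)
qed simp

text \<open>
  For \<open>p = c + b x + a x\<^sup>2\<close> the derivatives at \<open>m\<close> are \<open>b + 2 a m\<close> and \<open>2 a\<close>, so the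
  expansion is a ring identity once \<open>2 a / 2\<close> is \<open>a\<close>; characteristic zero is there for
  this division.
\<close>

lemma poly_quadratic_taylor:
  fixes p :: "'a :: field_char_0 poly"
  assumes "degree p \<le> 2"
  shows "poly p x = poly p m + poly (pderiv p) m * (x - m)
           + poly ((pderiv ^^ 2) p) m / 2 * (x - m)\<^sup>2"
proof -
  define c b a where "c = coeff p 0" and "b = coeff p 1" and "a = coeff p 2"
  have p: "p = [:c, b, a:]"
  proof (rule poly_eqI)
    fix n :: nat
    consider "n = 0" | "n = 1" | "n = 2" | "n > 2"
      by linarith
    then show "coeff p n = coeff [:c, b, a:] n"
      using assms
      by cases (auto simp: c_def b_def a_def coeff_eq_0 coeff_pCons numeral_2_eq_2 split: nat.splits)
  qed
  have p1: "pderiv p = [:b, 2 * a:]"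
    by (simp add: p pderiv_pCons)
  have p2: "(pderiv ^^ 2) p = [:2 * a:]"
    by (simp add: eval_nat_numeral p1 pderiv_pCons)
  show ?thesis
    by (simp add: p1 p2) (simp add: p power2_eq_square algebra_simps)
qed

theorem proposition1:
  fixes M :: "'a measure" and X :: "'a \<Rightarrow> real" and p :: "real poly"
  assumes "prob_space M"
    and "X \<in> borel_measurable M"
    and "integrable M X"
    and "integrable M (\<lambda>\<omega>. (X \<omega> - prob_space.expectation M X)\<^sup>2)"
    and "degree p = 2"
  shows "stat_diff_exact M X (poly p)"
proof -
  interpret prob_space M by fact
  note [simp] = assms(3)
  define m where "m = expectation X"
  define d1 d2 where "d1 = poly (pderiv p) m" and "d2 = poly ((pderiv ^^ 2) p) m"
  have taylor: "(\<lambda>\<omega>. poly p (X \<omega>)) =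
      (\<lambda>\<omega>. poly p m + d1 * (X \<omega> - m) + d2 / 2 * (X \<omega> - m)\<^sup>2)"
    unfolding d1_def d2_def by (rule ext, rule poly_quadratic_taylor) (simp add: assms(5))
  have square: "integrable M (\<lambda>\<omega>. (X \<omega> - m)\<^sup>2)"
    using assms(4) by (simp add: m_def)
  have linear: "integrable M (\<lambda>\<omega>. X \<omega> - m)"
    by simp
  have centred: "expectation (\<lambda>\<omega>. X \<omega> - m) = 0"
    by (simp add: m_def prob_space)
  have "integrable M (\<lambda>\<omega>. poly p (X \<omega>))"
    unfolding taylor using square by simp
  moreover have "expectation (\<lambda>\<omega>. poly p (X \<omega>)) = poly p m + d2 / 2 * variance X"
  proof -
    have "expectation (\<lambda>\<omega>. poly p (X \<omega>)) =
        poly p m + d1 * expectation (\<lambda>\<omega>. X \<omega> - m) + d2 / 2 * expectation (\<lambda>\<omega>. (X \<omega> - m)\<^sup>2)"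
      unfolding taylor using square linear by (simp add: prob_space del: Bochner_Integration.integral_diff)
    then show ?thesis
      using centred by (simp add: m_def)
  qed
  moreover have "(deriv ^^ 2) (poly p) m = d2"
    by (simp only: higher_deriv_poly d2_def)
  ultimately show ?thesis
    by (simp add: stat_diff_exact_def stat_diff_approx_def Let_def m_def)
qed

end
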